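(* Let $\alpha, \beta \in \mathbb{T}$ and let $T_{\alpha,\beta} : \mathrm{Hol}(\mathbb{A}) \to \mathrm{Hol}(\mathbb{A})$ be defined by $$T_{\alpha,\beta}(f)(z) = \alpha f(\beta z), \quad f \in \mathrm{Hol}(\mathbb{A}).$$ (1) If there exists $n \in \mathbb{N}$ such that $\beta^n = 1$, then $$\sigma_p(T_{\alpha,\beta}) = \sigma(T_{\alpha,\beta}) = \{\alpha\beta^k : 0 \le k \le n-1\}.$$ Moreover, for all $\lambda \in \sigma_p(T_{\alpha,\beta})$, $\mathrm{Ker}(T_{\alpha,\beta} - \lambda\,\mathrm{Id})$ has infinite dimension. (2) If $\beta^n \ne 1$ for all $n \in \mathbb{Z} \setminus \{0\}$, then $$\sigma_p(T_{\alpha,\beta}) = \{\alpha\beta^k : k \in \mathbb{Z}\} \subset \sigma(T_{\alpha,\beta}) \subset \mathbb{T}.$$ Moreover, for all $\lambda \in \sigma_p(T_{\alpha,\beta})$, $\mathrm{Ker}(T_{\alpha,\beta} - \lambda\,\mathrm{Id})$ has dimension $1$.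
   Context: Fix a real number $R > 1$ and let $\mathbb{A} = \{z \in \mathbb{C} : 1/R < |z| < R\}$. $\mathrm{Hol}(\mathbb{A})$ is the Fréchet space of holomorphic functions $\mathbb{A} \to \mathbb{C}$ with the topology of uniform convergence on compact subsets. $\mathbb{T}$ is the unit circle and $\mathbb{N} = \{1,2,3,\dots\}$. For a continuous linear operator $T$ on $\mathrm{Hol}(\mathbb{A})$, the spectrum $\sigma(T)$ is the set of $\lambda \in \mathbb{C}$ such that $T - \lambda\,\mathrm{Id}$ is not invertible on $\mathrm{Hol}(\mathbb{A})$, and the point spectrum $\sigma_p(T)$ is the set of $\lambda \in \mathbb{C}$ such that $T - \lambda\,\mathrm{Id}$ is not injective (the eigenvalues of $T$). The symbol $\subset$ denotes inclusion, not necessarily strict. *)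

theory Defs
  imports
    "HOL-Complex_Analysis.Complex_Analysis"
    "HOL-Library.Function_Algebras"
begin

definition annulus :: "real \<Rightarrow> complex set" where
  "annulus R = {z. 1 / R < norm z \<and> norm z < R}"

(* A holomorphic function on U is represented by its extension by zero to the whole plane,
   so that equality in Hol U is equality of HOL functions and Hol U is a linear subspace of
   the space of all functions from complex to complex. *)
definition Hol :: "complex set \<Rightarrow> (complex \<Rightarrow> complex) set" where
  "Hol U = {f. f holomorphic_on U \<and> (\<forall>z. z \<notin> U \<longrightarrow> f z = 0)}"

definition fscale :: "complex \<Rightarrow> (complex \<Rightarrow> complex) \<Rightarrow> (complex \<Rightarrow> complex)" where
  "fscale c f = (\<lambda>z. c * f z)"

interpretation cfun: vector_space fscale
  by unfold_locales (auto simp: fscale_def fun_eq_iff algebra_simps)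

(* The topology of uniform convergence on compact subsets of U.  As K is compact and f, g are
   continuous on K, the pointwise strict bound says that the supremum over K is below e. *)
definition Hol_topology :: "complex set \<Rightarrow> (complex \<Rightarrow> complex) topology" where
  "Hol_topology U = topology_generated_by
     {{g \<in> Hol U. \<forall>z\<in>K. dist (f z) (g z) < e} | f K e.
        f \<in> Hol U \<and> compact K \<and> K \<subseteq> U \<and> 0 < e}"

(* Operators are HOL functions on all of complex => complex; only their values on Hol U matter. *)
definition cont_lin_op ::
    "complex set \<Rightarrow> ((complex \<Rightarrow> complex) \<Rightarrow> (complex \<Rightarrow> complex)) \<Rightarrow> bool" where
  "cont_lin_op U T \<longleftrightarrow>
     (\<forall>f\<in>Hol U. T f \<in> Hol U) \<and>
     (\<forall>f\<in>Hol U. \<forall>g\<in>Hol U. T (f + g) = T f + T g) \<and>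
     (\<forall>c. \<forall>f\<in>Hol U. T (fscale c f) = fscale c (T f)) \<and>
     continuous_map (Hol_topology U) (Hol_topology U) T"

definition shift_op ::
    "((complex \<Rightarrow> complex) \<Rightarrow> (complex \<Rightarrow> complex)) \<Rightarrow> complex \<Rightarrow> (complex \<Rightarrow> complex) \<Rightarrow> (complex \<Rightarrow> complex)" where
  "shift_op T \<mu> = (\<lambda>f. T f - fscale \<mu> f)"

(* Invertible in the algebra of continuous linear operators on Hol U. *)
definition invertible_op ::
    "complex set \<Rightarrow> ((complex \<Rightarrow> complex) \<Rightarrow> (complex \<Rightarrow> complex)) \<Rightarrow> bool" where
  "invertible_op U T \<longleftrightarrow>
     (\<exists>S. cont_lin_op U S \<and> (\<forall>f\<in>Hol U. S (T f) = f \<and> T (S f) = f))"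

definition spectrum ::
    "complex set \<Rightarrow> ((complex \<Rightarrow> complex) \<Rightarrow> (complex \<Rightarrow> complex)) \<Rightarrow> complex set" where
  "spectrum U T = {\<mu>. \<not> invertible_op U (shift_op T \<mu>)}"

definition point_spectrum ::
    "complex set \<Rightarrow> ((complex \<Rightarrow> complex) \<Rightarrow> (complex \<Rightarrow> complex)) \<Rightarrow> complex set" where
  "point_spectrum U T = {\<mu>. \<not> inj_on (shift_op T \<mu>) (Hol U)}"

definition Ker ::
    "complex set \<Rightarrow> ((complex \<Rightarrow> complex) \<Rightarrow> (complex \<Rightarrow> complex)) \<Rightarrow> (complex \<Rightarrow> complex) set" where
  "Ker U T = {f \<in> Hol U. T f = 0}"

definition infinite_dim :: "(complex \<Rightarrow> complex) set \<Rightarrow> bool" where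
  "infinite_dim V \<longleftrightarrow> \<not> (\<exists>B. finite B \<and> V \<subseteq> cfun.span B)"

(* For norm \<beta> = 1, extension by zero outside the annulus is preserved. *)
definition rot_op :: "complex \<Rightarrow> complex \<Rightarrow> (complex \<Rightarrow> complex) \<Rightarrow> (complex \<Rightarrow> complex)" where
  "rot_op \<alpha> \<beta> f = (\<lambda>z. \<alpha> * f (\<beta> * z))"

lemma topspace_Hol_topology: "topspace (Hol_topology U) = Hol U"
proof -
  have "Hol U \<subseteq> \<Union> {{g \<in> Hol U. \<forall>z\<in>K. dist (f z) (g z) < e} | f K e.
        f \<in> Hol U \<and> compact K \<and> K \<subseteq> U \<and> 0 < e}"
  proof
    fix f assume f: "f \<in> Hol U"
    have "Hol U = {g \<in> Hol U. \<forall>z\<in>{}. dist (f z) (g z) < (1::real)}" by simp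
    moreover have "compact ({}::complex set)" "{} \<subseteq> U" "0 < (1::real)" by auto
    ultimately show "f \<in> \<Union> {{g \<in> Hol U. \<forall>z\<in>K. dist (f z) (g z) < e} | f K e.
        f \<in> Hol U \<and> compact K \<and> K \<subseteq> U \<and> 0 < e}" using f by blast
  qed
  then show ?thesis
    unfolding Hol_topology_def topspace_def[symmetric] topology_generated_by_topspace
    by blast
qed

lemma rot_op_in_Hol:
  assumes "norm \<beta> = 1" "f \<in> Hol (annulus R)"
  shows "rot_op \<alpha> \<beta> f \<in> Hol (annulus R)"
proof -
  have iff: "\<beta> * z \<in> annulus R \<longleftrightarrow> z \<in> annulus R" for z
    using assms(1) by (simp add: annulus_def norm_mult)
  have "(f \<circ> (\<lambda>z. \<beta> * z)) holomorphic_on annulus R"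
    by (rule holomorphic_on_compose_gen[where t = "annulus R"])
      (use assms iff in \<open>auto intro!: holomorphic_intros simp: Hol_def\<close>)
  then have "(\<lambda>z. \<alpha> * f (\<beta> * z)) holomorphic_on annulus R"
    by (auto intro!: holomorphic_intros simp: o_def)
  then show ?thesis
    using assms(2) iff by (auto simp: Hol_def rot_op_def)
qed

lemma cont_lin_op_rot_op:
  assumes "norm \<alpha> = 1" "norm \<beta> = 1"
  shows "cont_lin_op (annulus R) (rot_op \<alpha> \<beta>)"
proof -
  have ab: "\<alpha> \<noteq> 0" "\<beta> \<noteq> 0" using assms by auto
  have iff: "\<beta> * z \<in> annulus R \<longleftrightarrow> z \<in> annulus R" for z
    using assms(2) by (simp add: annulus_def norm_mult)
  have cont: "continuous_map (Hol_topology (annulus R)) (Hol_topology (annulus R)) (rot_op \<alpha> \<beta>)"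
    unfolding Hol_topology_def [of "annulus R"]
  proof (rule continuous_on_generated_topo, goal_cases)
    case (1 W)
    then obtain f K e where W: "W = {g \<in> Hol (annulus R). \<forall>z\<in>K. dist (f z) (g z) < e}"
      and f: "f \<in> Hol (annulus R)" and K: "compact K" "K \<subseteq> annulus R" and e: "0 < e" by auto
    define h where "h = rot_op (inverse \<alpha>) (inverse \<beta>) f"
    have h: "h \<in> Hol (annulus R)"
      unfolding h_def using assms f by (intro rot_op_in_Hol) (auto simp: norm_inverse)
    have "dist (f z) (rot_op \<alpha> \<beta> g z) = dist (h (\<beta> * z)) (g (\<beta> * z))" for g z
    proof -
      have "f z = \<alpha> * h (\<beta> * z)" using ab by (simp add: h_def rot_op_def field_simps)
      then have "dist (f z) (rot_op \<alpha> \<beta> g z) = norm (\<alpha> * (h (\<beta> * z) - g (\<beta> * z)))"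
        by (simp add: rot_op_def dist_norm algebra_simps)
      then show ?thesis using assms by (simp add: norm_mult dist_norm)
    qed
    then have "rot_op \<alpha> \<beta> -` W \<inter> Hol (annulus R) =
        {g \<in> Hol (annulus R). \<forall>z\<in>(\<lambda>z. \<beta> * z) ` K. dist (h z) (g z) < e}"
      using rot_op_in_Hol[OF assms(2)] by (auto simp: W)
    moreover have "compact ((\<lambda>z. \<beta> * z) ` K)"
      using K by (intro compact_continuous_image continuous_intros)
    moreover have "(\<lambda>z. \<beta> * z) ` K \<subseteq> annulus R" using K iff by auto
    ultimately have "openin (Hol_topology (annulus R)) (rot_op \<alpha> \<beta> -` W \<inter> Hol (annulus R))"
      unfolding Hol_topology_def using h e
      by (intro topology_generated_by_Basis CollectI exI[of _ h] exI[of _ "(\<lambda>z. \<beta> * z) ` K"] exI[of _ e] conjI)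
    then show ?case
      by (simp add: topspace_Hol_topology Hol_topology_def[symmetric])
  next
    case 2
    then show ?case
      using topspace_Hol_topology[of "annulus R"] rot_op_in_Hol[OF assms(2)]
      by (auto simp: Hol_topology_def topology_generated_by_topspace)
  qed
  show ?thesis
    unfolding cont_lin_op_def
    using rot_op_in_Hol[OF assms(2)] cont
    by (auto simp: rot_op_def fscale_def fun_eq_iff algebra_simps)
qed

end

theory Submission
  imports Defs
begin

text \<open>Every resolvent needed is a series \<open>\<Sum>j. a j * f (\<gamma> ^ j * z)\<close> of rotations with
  absolutely summable coefficients: a Neumann series off the unit circle, a finite geometric sum
  when \<open>\<beta>\<close> is a root of unity. Such a series is controlled on a compact set by the supremum of
  \<open>f\<close> on the circular hull of that set, so it is a continuous operator.

  If \<open>\<beta>\<close> has infinite order, its powers accumulate on the unit circle, so an eigenfunction behaves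
  like a character under all rotations. Differentiating in the rotation parameter yields
  \<open>z f' z = \<kappa> f z\<close>; integrating once around a circle forces \<open>\<kappa>\<close> to be an integer, and therefore
  the eigenfunctions are exactly the multiples of the monomials \<open>z powi k\<close>.\<close>

subsection \<open>Rotation-invariant compact sets\<close>

lemma open_annulus: "open (annulus R)"
  unfolding annulus_def by (intro open_Collect_conj open_Collect_less continuous_intros)

lemma rotation_in_annulus_iff:
  assumes "norm w = 1"
  shows "w * z \<in> annulus R \<longleftrightarrow> z \<in> annulus R"
  using assms by (simp add: annulus_def norm_mult)

text \<open>The union of all rotates of \<open>K\<close>. As a continuous image of a product it
  inherits compactness from \<open>K\<close>.\<close>

definition circular_hull :: "complex set \<Rightarrow> complex set" where
  "circular_hull K = (\<lambda>(w, z). w * z) ` (sphere 0 1 \<times> K)"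

lemma compact_circular_hull: "compact K \<Longrightarrow> compact (circular_hull K)"
  unfolding circular_hull_def case_prod_unfold
  by (intro compact_continuous_image compact_Times compact_sphere continuous_intros)

lemma circular_hull_subset_annulus: "K \<subseteq> annulus R \<Longrightarrow> circular_hull K \<subseteq> annulus R"
  unfolding circular_hull_def using rotation_in_annulus_iff by auto

lemma rotation_in_circular_hull: "norm w = 1 \<Longrightarrow> z \<in> K \<Longrightarrow> w * z \<in> circular_hull K"
  unfolding circular_hull_def by force

lemma Hol_continuous_on: "f \<in> Hol U \<Longrightarrow> K \<subseteq> U \<Longrightarrow> continuous_on K f"
  using holomorphic_on_imp_continuous_on continuous_on_subset unfolding Hol_def by blast

lemma Hol_bounded_on_compact:
  assumes "f \<in> Hol U" "compact K" "K \<subseteq> U"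
  shows "\<exists>M. \<forall>z\<in>K. norm (f z) \<le> M"
proof -
  have "continuous_on K f"
    using assms Hol_continuous_on by blast
  then have "bounded (f ` K)"
    using assms compact_continuous_image compact_imp_bounded by blast
  then show ?thesis by (simp add: bounded_iff)
qed

lemma Hol_diff: "f \<in> Hol U \<Longrightarrow> g \<in> Hol U \<Longrightarrow> f - g \<in> Hol U"
  by (auto simp: Hol_def fun_diff_def intro!: holomorphic_intros)

lemma Hol_scale: "f \<in> Hol U \<Longrightarrow> fscale c f \<in> Hol U"
  by (auto simp: Hol_def fscale_def intro!: holomorphic_intros)

subsection \<open>Continuity from estimates on compact sets\<close>

text \<open>Compatibility with differences reduces continuity to a seminorm estimate: the supremum
  of \<open>T f\<close> over \<open>K\<close> is at most \<open>C\<close> times that of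
  \<open>f\<close> over \<open>K'\<close>. The bound \<open>M\<close> stands in for the supremum,
  and \<open>M\<ge>0\<close> covers an empty \<open>K'\<close>.\<close>

lemma continuous_map_Hol_topologyI:
  assumes maps: "\<And>f. f \<in> Hol U \<Longrightarrow> T f \<in> Hol U"
    and diff: "\<And>f g. f \<in> Hol U \<Longrightarrow> g \<in> Hol U \<Longrightarrow> T f - T g = T (f - g)"
    and bound: "\<And>K. compact K \<Longrightarrow> K \<subseteq> U \<Longrightarrow>
      \<exists>K' C. compact K' \<and> K' \<subseteq> U \<and> 0 \<le> C \<and>
        (\<forall>f\<in>Hol U. \<forall>M\<ge>0. (\<forall>w\<in>K'. norm (f w) \<le> M) \<longrightarrow> (\<forall>z\<in>K. norm (T f z) \<le> C * M))"
  shows "continuous_map (Hol_topology U) (Hol_topology U) T"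
  unfolding Hol_topology_def [of U]
proof (rule continuous_on_generated_topo, goal_cases)
  case (1 W)
  then obtain f K e where W: "W = {g \<in> Hol U. \<forall>z\<in>K. dist (f z) (g z) < e}"
    and f: "f \<in> Hol U" and K: "compact K" "K \<subseteq> U" and e: "0 < e" by auto
  obtain K' C where K': "compact K'" "K' \<subseteq> U" and C: "0 \<le> C"
    and est: "\<And>f M z. f \<in> Hol U \<Longrightarrow> 0 \<le> M \<Longrightarrow> (\<And>w. w \<in> K' \<Longrightarrow> norm (f w) \<le> M) \<Longrightarrow> z \<in> K \<Longrightarrow>
      norm (T f z) \<le> C * M"
    using bound[OF K] by metis
  have "openin (Hol_topology U) (T -` W \<inter> Hol U)"
  \<comment> \<open>A subbasic set is centred at \<open>f\<close>, but its preimage needs a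
    neighbourhood of each of its points \<open>g\<close>, so some slack around \<open>T g\<close>
    has to be found.\<close>
  proof (subst openin_subopen, intro ballI)
    fix g assume "g \<in> T -` W \<inter> Hol U"
    then have g: "g \<in> Hol U" and Tg: "\<And>z. z \<in> K \<Longrightarrow> dist (f z) (T g z) < e"
      by (auto simp: W)
    \<comment> \<open>The continuous distance attains its maximum on \<open>K\<close>, which turns
      the pointwise strict bound into a uniform one; the gap \<open>e - s\<close> is the room left
      for moving \<open>g\<close>.\<close>
    obtain s where s: "s < e" "\<And>z. z \<in> K \<Longrightarrow> dist (f z) (T g z) \<le> s"
    proof (cases "K = {}")
      case True
      then show ?thesis using that[of 0] e by auto
    next
      case False
      have "continuous_on K (\<lambda>z. dist (f z) (T g z))"
        by (intro continuous_on_dist Hol_continuous_on[OF f K(2)] Hol_continuous_on[OF maps[OF g] K(2)])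
      then obtain x where "x \<in> K" "\<And>z. z \<in> K \<Longrightarrow> dist (f z) (T g z) \<le> dist (f x) (T g x)"
        using continuous_attains_sup[OF K(1) False] by blast
      then show ?thesis using that Tg by blast
    qed
    \<comment> \<open>Dividing by \<open>C + 1\<close> instead of \<open>C\<close> allows
      \<open>C = 0\<close> and makes \<open>C * d\<close> strictly smaller than
      \<open>e - s\<close>.\<close>
    define d where "d = (e - s) / (C + 1)"
    have d: "0 < d" and Cd: "s + C * d < e"
      using s(1) C by (auto simp: d_def field_simps)
    define N where "N = {h \<in> Hol U. \<forall>z\<in>K'. dist (g z) (h z) < d}"
    have "openin (Hol_topology U) N"
      unfolding Hol_topology_def N_def
      using g K' d by (intro topology_generated_by_Basis) auto
    moreover have "g \<in> N" using g d by (simp add: N_def)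
    moreover have "N \<subseteq> T -` W \<inter> Hol U"
    proof
      fix h assume "h \<in> N"
      then have h: "h \<in> Hol U" and gh: "\<And>z. z \<in> K' \<Longrightarrow> norm ((g - h) z) \<le> d"
        by (auto simp: N_def dist_norm less_imp_le)
      have "dist (f z) (T h z) < e" if z: "z \<in> K" for z
      proof -
        have "dist (T g z) (T h z) \<le> C * d"
          using est[OF Hol_diff[OF g h] less_imp_le[OF d] gh z] diff[OF g h]
          by (simp add: dist_norm flip: minus_apply)
        then show ?thesis
          using s(2)[OF z] Cd dist_triangle[of "f z" "T h z" "T g z"] by linarith
      qed
      then show "h \<in> T -` W \<inter> Hol U" using h maps by (simp add: W)
    qed
    ultimately show "\<exists>N. openin (Hol_topology U) N \<and> g \<in> N \<and> N \<subseteq> T -` W \<inter> Hol U" by blast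
  qed
  then show ?case
    by (simp add: topspace_Hol_topology Hol_topology_def[symmetric])
next
  case 2
  then show ?case
    using topspace_Hol_topology[of U] maps
    by (auto simp: Hol_topology_def topology_generated_by_topspace)
qed

subsection \<open>Series of rotations\<close>

text \<open>Formally the power series with coefficients \<open>a\<close> in the operator
  \<open>rot_op 1 \<gamma>\<close>; powers of \<alpha> are absorbed into \<open>a\<close>.\<close>

definition rot_series :: "(nat \<Rightarrow> complex) \<Rightarrow> complex \<Rightarrow> (complex \<Rightarrow> complex) \<Rightarrow> complex \<Rightarrow> complex" where
  "rot_series a \<gamma> f = (\<lambda>z. \<Sum>j. a j * f (\<gamma> ^ j * z))"

context
  fixes R :: real and \<gamma> :: complex and a :: "nat \<Rightarrow> complex"
  assumes \<gamma>: "norm \<gamma> = 1" and a: "summable (\<lambda>j. norm (a j))"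
begin

lemma summable_rot_series_norm:
  assumes f: "f \<in> Hol (annulus R)"
  shows "summable (\<lambda>j. norm (a j * f (\<gamma> ^ j * z)))"
proof (cases "z \<in> annulus R")
  case True
  then have "circular_hull {z} \<subseteq> annulus R" "compact (circular_hull {z})"
    by (simp_all add: circular_hull_subset_annulus compact_circular_hull)
  then obtain M where M: "\<forall>w\<in>circular_hull {z}. norm (f w) \<le> M"
    using Hol_bounded_on_compact[OF f] by blast
  then have "norm (f (\<gamma> ^ j * z)) \<le> M" for j
    using M \<gamma> rotation_in_circular_hull[of "\<gamma> ^ j" z "{z}"] by (simp add: norm_power)
  then show ?thesis
    by (intro summable_comparison_test'[OF summable_mult2[OF a, of M], of 0])
      (auto simp: norm_mult intro!: mult_left_mono)
next
  case False
  then have "f (\<gamma> ^ j * z) = 0" for j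
    using f \<gamma> rotation_in_annulus_iff[of "\<gamma> ^ j" z R] by (auto simp: Hol_def norm_power)
  then show ?thesis by simp
qed

lemma summable_rot_series:
  "f \<in> Hol (annulus R) \<Longrightarrow> summable (\<lambda>j. a j * f (\<gamma> ^ j * z))"
  by (rule summable_norm_cancel, rule summable_rot_series_norm)

lemma rot_series_bound:
  assumes f: "f \<in> Hol (annulus R)" and M: "\<And>w. w \<in> circular_hull K \<Longrightarrow> norm (f w) \<le> M"
    and z: "z \<in> K"
  shows "norm (rot_series a \<gamma> f z) \<le> (\<Sum>j. norm (a j)) * M"
proof -
  have "norm (a j * f (\<gamma> ^ j * z)) \<le> norm (a j) * M" for j
    unfolding norm_mult
    using M[OF rotation_in_circular_hull[OF _ z, of "\<gamma> ^ j"]] \<gamma>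
    by (intro mult_left_mono) (simp_all add: norm_power)
  then have "norm (rot_series a \<gamma> f z) \<le> (\<Sum>j. norm (a j) * M)"
    unfolding rot_series_def by (intro norm_suminf_le summable_mult2 a)
  then show ?thesis using suminf_mult2[OF a, of M] by simp
qed

text \<open>The circular hull of a closed disc in the annulus is compact and stays in the annulus,
  so a single bound for \<open>f\<close> there feeds the Weierstrass M-test. The partial sums
  therefore converge locally uniformly.\<close>

lemma rot_series_in_Hol:
  assumes f: "f \<in> Hol (annulus R)"
  shows "rot_series a \<gamma> f \<in> Hol (annulus R)"
proof -
  have "rot_series a \<gamma> f holomorphic_on annulus R"
  proof (rule holomorphic_uniform_sequence[OF open_annulus])
    show "(\<lambda>z. \<Sum>j<n. a j * f (\<gamma> ^ j * z)) holomorphic_on annulus R" for n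
    proof (intro holomorphic_intros)
      fix j
      have "rot_op 1 (\<gamma> ^ j) f \<in> Hol (annulus R)"
        using \<gamma> f by (intro rot_op_in_Hol) (auto simp: norm_power)
      then show "(\<lambda>z. f (\<gamma> ^ j * z)) holomorphic_on annulus R"
        by (simp add: Hol_def rot_op_def)
    qed
  next
    fix x assume "x \<in> annulus R"
    then obtain d where d: "0 < d" "cball x d \<subseteq> annulus R"
      using open_annulus open_contains_cball by blast
    obtain M where M: "\<forall>w\<in>circular_hull (cball x d). norm (f w) \<le> M"
      using Hol_bounded_on_compact[OF f compact_circular_hull[OF compact_cball]
          circular_hull_subset_annulus[OF d(2)]] by blast
    have "uniform_limit (cball x d) (\<lambda>n z. \<Sum>j<n. a j * f (\<gamma> ^ j * z))
        (\<lambda>z. \<Sum>j. a j * f (\<gamma> ^ j * z)) sequentially"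
    proof (rule Weierstrass_m_test)
      show "norm (a j * f (\<gamma> ^ j * z)) \<le> norm (a j) * M" if "z \<in> cball x d" for j z
        unfolding norm_mult
        using M rotation_in_circular_hull[OF _ that, of "\<gamma> ^ j"] \<gamma>
        by (intro mult_left_mono) (simp_all add: norm_power)
      show "summable (\<lambda>j. norm (a j) * M)" by (rule summable_mult2[OF a])
    qed
    then show "\<exists>d>0. cball x d \<subseteq> annulus R \<and>
        uniform_limit (cball x d) (\<lambda>n z. \<Sum>j<n. a j * f (\<gamma> ^ j * z)) (rot_series a \<gamma> f) sequentially"
      using d unfolding rot_series_def by blast
  qed
  moreover have "rot_series a \<gamma> f z = 0" if "z \<notin> annulus R" for z
  proof -
    have "f (\<gamma> ^ j * z) = 0" for j
      using f \<gamma> that rotation_in_annulus_iff[of "\<gamma> ^ j" z R] by (auto simp: Hol_def norm_power)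
    then show ?thesis by (simp add: rot_series_def)
  qed
  ultimately show ?thesis by (simp add: Hol_def)
qed

lemma cont_lin_op_rot_series: "cont_lin_op (annulus R) (rot_series a \<gamma>)"
  unfolding cont_lin_op_def
proof (intro conjI ballI allI)
  fix f g assume f: "f \<in> Hol (annulus R)" and g: "g \<in> Hol (annulus R)"
  show "rot_series a \<gamma> f \<in> Hol (annulus R)" by (rule rot_series_in_Hol[OF f])
  show "rot_series a \<gamma> (f + g) = rot_series a \<gamma> f + rot_series a \<gamma> g"
    by (simp add: rot_series_def fun_eq_iff distrib_left
        suminf_add[OF summable_rot_series[OF f] summable_rot_series[OF g]])
next
  fix c f assume f: "f \<in> Hol (annulus R)"
  show "rot_series a \<gamma> (fscale c f) = fscale c (rot_series a \<gamma> f)"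
    by (simp add: rot_series_def fscale_def fun_eq_iff mult.left_commute[of _ c]
        suminf_mult[OF summable_rot_series[OF f]])
next
  show "continuous_map (Hol_topology (annulus R)) (Hol_topology (annulus R)) (rot_series a \<gamma>)"
  proof (rule continuous_map_Hol_topologyI)
    fix f g assume f: "f \<in> Hol (annulus R)" and g: "g \<in> Hol (annulus R)"
    show "rot_series a \<gamma> f - rot_series a \<gamma> g = rot_series a \<gamma> (f - g)"
      by (simp add: rot_series_def fun_eq_iff right_diff_distrib
          suminf_diff[OF summable_rot_series[OF f] summable_rot_series[OF g]])
  next
    fix K assume K: "compact K" "K \<subseteq> annulus R"
    show "\<exists>K' C. compact K' \<and> K' \<subseteq> annulus R \<and> 0 \<le> C \<and>
        (\<forall>f\<in>Hol (annulus R). \<forall>M\<ge>0. (\<forall>w\<in>K'. norm (f w) \<le> M) \<longrightarrow>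
          (\<forall>z\<in>K. norm (rot_series a \<gamma> f z) \<le> C * M))"
    \<comment> \<open>All points at which the series over \<open>K\<close> evaluates
      \<open>f\<close> lie in the hull, and the constant is the l1 norm of the coefficients.\<close>
    proof (intro exI[of _ "circular_hull K"] exI[of _ "\<Sum>j. norm (a j)"] conjI ballI allI impI)
      show "compact (circular_hull K)" "circular_hull K \<subseteq> annulus R" "0 \<le> (\<Sum>j. norm (a j))"
        using K a by (simp_all add: compact_circular_hull circular_hull_subset_annulus suminf_nonneg)
    qed (use rot_series_bound in blast)
  qed (rule rot_series_in_Hol)
qed

text \<open>Rotations commute, so a right inverse of this form is also a left inverse.\<close>

lemma invertible_shift_rot_op:
  assumes inv: "\<And>f z. f \<in> Hol (annulus R) \<Longrightarrow>
      \<alpha> * rot_series a \<gamma> f (\<beta> * z) - \<mu> * rot_series a \<gamma> f z = f z"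
    and \<beta>: "norm \<beta> = 1"
  shows "invertible_op (annulus R) (shift_op (rot_op \<alpha> \<beta>) \<mu>)"
  unfolding invertible_op_def
proof (intro exI[of _ "rot_series a \<gamma>"] conjI ballI)
  show "cont_lin_op (annulus R) (rot_series a \<gamma>)" by (rule cont_lin_op_rot_series)
  fix f assume f: "f \<in> Hol (annulus R)"
  show right: "shift_op (rot_op \<alpha> \<beta>) \<mu> (rot_series a \<gamma> f) = f"
    using inv[OF f] by (simp add: shift_op_def rot_op_def fscale_def fun_eq_iff)
  have "rot_series a \<gamma> (shift_op (rot_op \<alpha> \<beta>) \<mu> f) z = shift_op (rot_op \<alpha> \<beta>) \<mu> (rot_series a \<gamma> f) z" for z
  proof -
    have "summable (\<lambda>j. \<alpha> * (a j * f (\<gamma> ^ j * (\<beta> * z))))" "summable (\<lambda>j. \<mu> * (a j * f (\<gamma> ^ j * z)))"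
      by (intro summable_mult summable_rot_series[OF f])+
    from suminf_diff[OF this] show ?thesis
      unfolding suminf_mult[OF summable_rot_series[OF f]]
      by (simp add: rot_series_def shift_op_def rot_op_def fscale_def algebra_simps)
  qed
  with right show "rot_series a \<gamma> (shift_op (rot_op \<alpha> \<beta>) \<mu> f) = f" by auto
qed

end


section \<open>Resolvents off the unit circle and at roots of unity\<close>

text \<open>With \<open>T = rot_op \<alpha> \<beta>\<close>, the inverse of \<open>T - \<mu>\<close>
  is the Neumann series with terms \<open>- T^j / \<mu>^(j+1)\<close>, whose coefficients decay
  geometrically because \<alpha> is unimodular.\<close>

lemma invertible_shift_rot_op_large:
  assumes "norm \<alpha> = 1" "norm \<beta> = 1" "1 < norm \<mu>"
  shows "invertible_op (annulus R) (shift_op (rot_op \<alpha> \<beta>) \<mu>)"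
proof -
  define a where "a = (\<lambda>j. - (\<alpha> ^ j / \<mu> ^ Suc j))"
  have "norm (a j) = inverse (norm \<mu>) * inverse (norm \<mu>) ^ j" for j
    using assms by (simp add: a_def norm_divide norm_mult norm_power field_simps)
  moreover have "summable (\<lambda>j. inverse (norm \<mu>) * inverse (norm \<mu>) ^ j)"
    using assms by (intro summable_mult summable_geometric) (simp add: inverse_less_1_iff)
  ultimately have a: "summable (\<lambda>j. norm (a j))" by simp
  show ?thesis
  proof (rule invertible_shift_rot_op[OF assms(2) a _ assms(2)])
    fix f z assume f: "f \<in> Hol (annulus R)"
    note sm = summable_rot_series[OF assms(2) a f]
    \<comment> \<open>Applying \<open>T\<close> to a term gives \<mu> times the next term, so
      everything cancels except \<open>- \<mu> * a 0 * f z\<close>, which is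
      \<open>f z\<close>.\<close>
    have "\<alpha> * (a j * f (\<beta> ^ j * (\<beta> * z))) = \<mu> * (a (Suc j) * f (\<beta> ^ Suc j * z))" for j
      using assms by (auto simp: a_def field_simps)
    then have "\<alpha> * rot_series a \<beta> f (\<beta> * z) = (\<Sum>j. \<mu> * (a (Suc j) * f (\<beta> ^ Suc j * z)))"
      unfolding rot_series_def by (simp only: suminf_mult[OF sm, symmetric])
    also have "\<dots> = (\<Sum>j. \<mu> * (a j * f (\<beta> ^ j * z))) - \<mu> * (a 0 * f (\<beta> ^ 0 * z))"
      by (rule suminf_split_head) (intro summable_mult sm)
    also have "\<dots> = \<mu> * rot_series a \<beta> f z + f z"
      using assms unfolding suminf_mult[OF sm] by (auto simp: rot_series_def a_def)
    finally show "\<alpha> * rot_series a \<beta> f (\<beta> * z) - \<mu> * rot_series a \<beta> f z = f z" by simp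
  qed
qed

text \<open>Here the expansion is in the inverse rotation: the inverse of \<open>T - \<mu>\<close>
  is the sum of \<open>\<mu>^i T^(-(i+1))\<close>, which converges for small \<mu>, zero
  included.\<close>

lemma invertible_shift_rot_op_small:
  assumes "norm \<alpha> = 1" "norm \<beta> = 1" "norm \<mu> < 1"
  shows "invertible_op (annulus R) (shift_op (rot_op \<alpha> \<beta>) \<mu>)"
proof -
  \<comment> \<open>The expansion starts with the first power of the inverse of \<open>T\<close>,
    hence the zero coefficient at \<open>0\<close> and the shifted index.\<close>
  define a where "a = (\<lambda>j. case j of 0 \<Rightarrow> 0 | Suc i \<Rightarrow> \<mu> ^ i / \<alpha> ^ Suc i)"
  define \<gamma> where "\<gamma> = inverse \<beta>"
  have \<gamma>: "norm \<gamma> = 1"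
    using assms by (simp add: \<gamma>_def norm_inverse)
  have \<gamma>\<beta>: "\<gamma> ^ Suc j * (\<beta> * z) = \<gamma> ^ j * z" for j z
  proof -
    have "inverse \<beta> * \<beta> = 1" using assms by (intro left_inverse) auto
    then show ?thesis by (simp add: \<gamma>_def)
  qed
  have "norm (a (Suc j)) = norm \<mu> ^ j" for j
    using assms by (simp add: a_def norm_divide norm_mult norm_power)
  moreover have "summable (\<lambda>j. norm \<mu> ^ j)"
    using assms by (intro summable_geometric) simp
  ultimately have a: "summable (\<lambda>j. norm (a j))"
    by (subst summable_Suc_iff[symmetric]) simp
  show ?thesis
  proof (rule invertible_shift_rot_op[OF \<gamma> a _ assms(2)])
    fix f z assume f: "f \<in> Hol (annulus R)"
    note sm = summable_rot_series[OF \<gamma> a f]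
    \<comment> \<open>The summands of \<open>T\<close> applied to the series. Since \<gamma> undoes
      \<beta>, the first is \<open>f z\<close>, and \<mu> times the series is the same sum without
      it.\<close>
    define t where "t = (\<lambda>j. \<alpha> * (a (Suc j) * f (\<gamma> ^ Suc j * (\<beta> * z))))"
    have tail: "rot_series a \<gamma> f w = (\<Sum>j. a (Suc j) * f (\<gamma> ^ Suc j * w))" for w
      using suminf_split_head[OF sm[of w]] by (simp add: rot_series_def a_def)
    have sm': "summable (\<lambda>j. a (Suc j) * f (\<gamma> ^ Suc j * w))" for w
      by (rule summable_Suc_iff[THEN iffD2, OF sm])
    have "\<mu> * (a (Suc j) * f (\<gamma> ^ Suc j * z)) = t (Suc j)" for j
      unfolding t_def \<gamma>\<beta> using assms by (auto simp: a_def field_simps)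
    then have "\<mu> * rot_series a \<gamma> f z = (\<Sum>j. t (Suc j))"
      unfolding tail suminf_mult[OF sm', symmetric] by simp
    also have "\<dots> = (\<Sum>j. t j) - t 0"
      by (rule suminf_split_head) (unfold t_def, intro summable_mult sm')
    also have "(\<Sum>j. t j) = \<alpha> * rot_series a \<gamma> f (\<beta> * z)"
      unfolding tail suminf_mult[OF sm', symmetric] t_def ..
    also have "t 0 = f z"
      unfolding t_def \<gamma>\<beta> using assms by (auto simp: a_def)
    finally show "\<alpha> * rot_series a \<gamma> f (\<beta> * z) - \<mu> * rot_series a \<gamma> f z = f z" by simp
  qed
qed

text \<open>With \<open>T = rot_op \<alpha> \<beta>\<close>, the inverse comes from
  \<open>(T - \<mu>) (\<Sum>j<m. \<mu>^(m-1-j) T^j) = T^m - \<mu>^m\<close> and \<open>T^m = \<alpha>^m\<close>.\<close>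

lemma invertible_shift_rot_op_root_of_unity:
  assumes \<beta>: "norm \<beta> = 1" and m: "\<beta> ^ m = 1" and \<mu>: "\<mu> ^ m \<noteq> \<alpha> ^ m"
  shows "invertible_op (annulus R) (shift_op (rot_op \<alpha> \<beta>) \<mu>)"
proof -
  \<comment> \<open>Padding with zeros makes the finite sum a \<open>rot_series\<close>; the
    denominator divides out the factor left by \<open>T^m - \<mu>^m\<close>.\<close>
  define a where "a = (\<lambda>j. if j < m then \<alpha> ^ j * \<mu> ^ (m - 1 - j) / (\<alpha> ^ m - \<mu> ^ m) else 0)"
  have a: "summable (\<lambda>j. norm (a j))"
    by (rule summable_finite[of "{..<m}"]) (auto simp: a_def)
  show ?thesis
  proof (rule invertible_shift_rot_op[OF \<beta> a _ \<beta>])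
    fix f z
    \<comment> \<open>Chosen so that \<open>T - \<mu>\<close> sends the summand with index
      \<open>j\<close> to \<open>b (Suc j) - b j\<close>, leaving only the two ends of a telescoping
      sum.\<close>
    define b where "b = (\<lambda>j. \<alpha> ^ j * \<mu> ^ (m - j) * f (\<beta> ^ j * z) / (\<alpha> ^ m - \<mu> ^ m))"
    have fin: "rot_series a \<beta> f w = (\<Sum>j<m. a j * f (\<beta> ^ j * w))" for w
      unfolding rot_series_def by (rule suminf_finite) (auto simp: a_def)
    have "\<alpha> * (a j * f (\<beta> ^ j * (\<beta> * z))) - \<mu> * (a j * f (\<beta> ^ j * z)) = b (Suc j) - b j"
      if "j < m" for j
    proof -
      have "\<mu> ^ (m - j) = \<mu> * \<mu> ^ (m - Suc j)"
        using that by (metis Suc_diff_Suc power_Suc)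
      then show ?thesis
        using that by (simp add: a_def b_def mult_ac)
    qed
    then have "\<alpha> * rot_series a \<beta> f (\<beta> * z) - \<mu> * rot_series a \<beta> f z = (\<Sum>j<m. b (Suc j) - b j)"
      by (simp add: fin sum_distrib_left flip: sum_subtractf)
    also have "\<dots> = b m - b 0" by (rule sum_lessThan_telescope)
    also have "\<dots> = (\<alpha> ^ m - \<mu> ^ m) * f z / (\<alpha> ^ m - \<mu> ^ m)"
      using m by (simp add: b_def diff_divide_distrib left_diff_distrib)
    also have "\<dots> = f z" using \<mu> by simp
    finally show "\<alpha> * rot_series a \<beta> f (\<beta> * z) - \<mu> * rot_series a \<beta> f z = f z" .
  qed
qed

subsection \<open>Eigenfunctions\<close>

lemma in_Ker_shift_rot_op_iff:
  "f \<in> Ker U (shift_op (rot_op \<alpha> \<beta>) \<mu>) \<longleftrightarrow> f \<in> Hol U \<and> (\<forall>z. \<alpha> * f (\<beta> * z) = \<mu> * f z)"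
  by (auto simp: Ker_def shift_op_def rot_op_def fscale_def fun_eq_iff)

lemma in_point_spectrum_rot_op_iff:
  "\<mu> \<in> point_spectrum U (rot_op \<alpha> \<beta>) \<longleftrightarrow> (\<exists>f\<in>Ker U (shift_op (rot_op \<alpha> \<beta>) \<mu>). f \<noteq> 0)"
proof
  assume "\<mu> \<in> point_spectrum U (rot_op \<alpha> \<beta>)"
  then obtain f g where "f \<in> Hol U" "g \<in> Hol U" "f \<noteq> g"
    and eq: "shift_op (rot_op \<alpha> \<beta>) \<mu> f = shift_op (rot_op \<alpha> \<beta>) \<mu> g"
    by (auto simp: point_spectrum_def inj_on_def)
  moreover have "\<alpha> * (f - g) (\<beta> * z) = \<mu> * (f - g) z" for z
    using fun_cong[OF eq, of z] by (simp add: shift_op_def rot_op_def fscale_def algebra_simps)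
  ultimately show "\<exists>f\<in>Ker U (shift_op (rot_op \<alpha> \<beta>) \<mu>). f \<noteq> 0"
    by (intro bexI[of _ "f - g"]) (auto simp: in_Ker_shift_rot_op_iff Hol_diff)
next
  assume "\<exists>f\<in>Ker U (shift_op (rot_op \<alpha> \<beta>) \<mu>). f \<noteq> 0"
  then obtain f where f: "f \<in> Hol U" "f \<noteq> 0" "shift_op (rot_op \<alpha> \<beta>) \<mu> f = 0"
    by (auto simp: Ker_def)
  have "0 \<in> Hol U" "shift_op (rot_op \<alpha> \<beta>) \<mu> 0 = 0"
    by (auto simp: Hol_def shift_op_def rot_op_def fscale_def fun_eq_iff zero_fun_def)
  with f have "\<not> inj_on (shift_op (rot_op \<alpha> \<beta>) \<mu>) (Hol U)"
    by (metis inj_onD)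
  then show "\<mu> \<in> point_spectrum U (rot_op \<alpha> \<beta>)"
    by (simp add: point_spectrum_def)
qed

lemma point_spectrum_subset_spectrum: "point_spectrum U T \<subseteq> spectrum U T"
proof
  fix \<mu> assume "\<mu> \<in> point_spectrum U T"
  then obtain f g where fg: "f \<in> Hol U" "g \<in> Hol U" "f \<noteq> g" "shift_op T \<mu> f = shift_op T \<mu> g"
    by (auto simp: point_spectrum_def inj_on_def)
  have False if "\<forall>f\<in>Hol U. S (shift_op T \<mu> f) = f \<and> shift_op T \<mu> (S f) = f" for S
    using that fg by metis
  then show "\<mu> \<in> spectrum U T"
    unfolding spectrum_def invertible_op_def by blast
qed

section \<open>Monomials and their linear independence\<close>

definition annulus_monomial :: "real \<Rightarrow> int \<Rightarrow> complex \<Rightarrow> complex" where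
  "annulus_monomial R k z = (if z \<in> annulus R then z powi k else 0)"

lemma zero_notin_annulus: "0 \<notin> annulus R"
  by (auto simp: annulus_def)

lemma one_in_annulus: "1 < R \<Longrightarrow> 1 \<in> annulus R"
  by (simp add: annulus_def)

lemma annulus_monomial_in_Hol: "annulus_monomial R k \<in> Hol (annulus R)"
proof -
  have "(\<lambda>z. z powi k) holomorphic_on annulus R"
    using zero_notin_annulus by (intro holomorphic_intros) auto
  then have "annulus_monomial R k holomorphic_on annulus R"
    by (rule holomorphic_transform) (simp add: annulus_monomial_def)
  then show ?thesis by (simp add: Hol_def annulus_monomial_def)
qed

lemma annulus_monomial_eigenfunction:
  assumes "norm \<beta> = 1"
  shows "annulus_monomial R k \<in> Ker (annulus R) (shift_op (rot_op \<alpha> \<beta>) (\<alpha> * \<beta> powi k))"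
  using annulus_monomial_in_Hol rotation_in_annulus_iff[OF assms]
  by (auto simp: in_Ker_shift_rot_op_iff annulus_monomial_def power_int_mult_distrib)

lemma annulus_monomial_neq_0:
  assumes "1 < R" shows "annulus_monomial R k \<noteq> 0"
proof -
  have "annulus_monomial R k 1 \<noteq> 0"
    using one_in_annulus[OF assms] by (simp add: annulus_monomial_def)
  then show ?thesis by (metis zero_fun_apply)
qed

lemma monomial_eigenvalue_in_point_spectrum:
  "1 < R \<Longrightarrow> norm \<beta> = 1 \<Longrightarrow> \<alpha> * \<beta> powi k \<in> point_spectrum (annulus R) (rot_op \<alpha> \<beta>)"
  using annulus_monomial_eigenfunction annulus_monomial_neq_0
  unfolding in_point_spectrum_rot_op_iff by blast

text \<open>A non-empty open set is infinite, whereas a non-zero polynomial has finitely many roots.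
  This transfers independence of monomials from polynomials to functions on the annulus.\<close>

lemma poly_eq_0_on_annulus:
  assumes R: "1 < R" and p: "\<And>z. z \<in> annulus R \<Longrightarrow> poly p z = 0"
  shows "p = 0"
proof (rule ccontr)
  assume "p \<noteq> 0"
  then have "finite (annulus R)"
    using p by (intro finite_subset[OF _ poly_roots_finite[of p]]) auto
  then show False
    using one_in_annulus[OF R] open_annulus finite_imp_not_open by blast
qed

lemma inj_annulus_monomial:
  assumes "1 < R" shows "inj (\<lambda>i. annulus_monomial R (int i))"
proof (rule injI)
  fix i j assume eq: "annulus_monomial R (int i) = annulus_monomial R (int j)"
  have "monom 1 i - monom 1 j = (0 :: complex poly)"
  proof (rule poly_eq_0_on_annulus[OF assms])
    show "poly (monom 1 i - monom 1 j) z = 0" if "z \<in> annulus R" for z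
      using fun_cong[OF eq, of z] that by (simp add: annulus_monomial_def poly_monom)
  qed
  then show "i = j" by (metis coeff_monom eq_iff_diff_eq_0 one_neq_zero)
qed

text \<open>With natural exponents only, a linear relation is a polynomial vanishing on the annulus.
  These exponents already suffice to make a kernel infinite-dimensional.\<close>

lemma independent_annulus_monomials:
  assumes "1 < R" shows "cfun.independent (range (\<lambda>i. annulus_monomial R (int i)))"
  unfolding cfun.independent_explicit_module
proof (intro allI impI)
  let ?e = "\<lambda>i. annulus_monomial R (int i)"
  fix t u v
  assume t: "finite t" "t \<subseteq> range ?e" and 0: "(\<Sum>v\<in>t. fscale (u v) v) = 0" and v: "v \<in> t"
  from t(2) obtain I where I: "t = ?e ` I"
    by (rule subset_imageE)
  have inj: "inj_on ?e I"
    using inj_annulus_monomial[OF assms] by (rule inj_on_subset) simp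
  have fin: "finite I"
    using t(1) inj by (simp add: I finite_image_iff)
  define c where "c = (\<lambda>i. u (?e i))"
  have "(\<Sum>i\<in>I. monom (c i) i) = 0"
  proof (rule poly_eq_0_on_annulus[OF assms])
    fix z assume z: "z \<in> annulus R"
    have app: "(\<Sum>i\<in>I. fscale (c i) (?e i)) z = (\<Sum>i\<in>I. c i * ?e i z)"
      using fin by (induction I) (auto simp: fscale_def)
    have "(\<Sum>i\<in>I. fscale (c i) (?e i)) = 0"
      using 0 by (simp add: I c_def sum.reindex[OF inj])
    from fun_cong[OF this, of z] show "poly (\<Sum>i\<in>I. monom (c i) i) z = 0"
      using z by (simp add: app annulus_monomial_def poly_sum poly_monom)
  qed
  moreover from v obtain i where i: "i \<in> I" "v = ?e i"
    unfolding I by (rule imageE)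
  ultimately have "coeff (\<Sum>i\<in>I. monom (c i) i) i = 0" by simp
  then have "c i = 0"
    using i(1) fin by (simp add: coeff_sum)
  then show "u v = 0" unfolding c_def i(2) .
qed

lemma infinite_dim_if_monomials:
  assumes "1 < R" "infinite I" "\<And>i. i \<in> I \<Longrightarrow> annulus_monomial R (int i) \<in> V"
  shows "infinite_dim V"
  unfolding infinite_dim_def
proof
  let ?e = "\<lambda>i. annulus_monomial R (int i)"
  assume "\<exists>B. finite B \<and> V \<subseteq> cfun.span B"
  then obtain B where B: "finite B" "V \<subseteq> cfun.span B" by blast
  have "cfun.independent (?e ` I)"
    by (rule cfun.independent_mono[OF independent_annulus_monomials[OF assms(1)]]) (rule image_mono, simp)
  moreover have "?e ` I \<subseteq> cfun.span B" using B assms(3) by blast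
  ultimately have "finite (?e ` I)"
    using cfun.independent_span_bound[OF B(1)] by simp
  moreover have "inj_on ?e I"
    using inj_annulus_monomial[OF assms(1)] by (rule inj_on_subset) simp
  ultimately show False using assms(2) by (simp add: finite_image_iff)
qed

section \<open>The Euler equation and the classification of eigenfunctions\<close>

text \<open>Along the circle \<open>z0 * exp (\<i> * t)\<close> the equation makes \<open>f\<close>
  a multiple of \<open>exp (\<i> * \<kappa> * t)\<close>. One full turn returns to
  \<open>z0\<close>, so \<open>2 * pi * \<i> * \<kappa>\<close> is a period of
  \<open>exp\<close>.\<close>

lemma logarithmic_derivative_integral:
  assumes S: "open S" and f: "f holomorphic_on S"
    and ode: "\<And>z. z \<in> S \<Longrightarrow> z * deriv f z = \<kappa> * f z"
    and z0: "sphere 0 (norm z0) \<subseteq> S" "f z0 \<noteq> 0"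
  obtains k :: int where "\<kappa> = of_int k"
proof -
  \<comment> \<open>The parameter is complex so that the complex chain rule applies, but only real
    \<open>t\<close> is known to stay in \<open>S\<close>; constancy is thus obtained on the convex
    set of reals.\<close>
  define h where "h = (\<lambda>t. f (z0 * exp (\<i> * t)) * exp (- (\<i> * \<kappa> * t)))"
  have "\<exists>c. \<forall>t\<in>\<real>. h t = c"
  proof (rule has_field_derivative_zero_constant)
    fix t :: complex assume "t \<in> \<real>"
    then have in_S: "z0 * exp (\<i> * t) \<in> S"
      using z0(1) by (auto simp: norm_mult norm_exp_i_times elim!: Reals_cases)
    have df: "(f has_field_derivative deriv f (z0 * exp (\<i> * t))) (at (z0 * exp (\<i> * t)))"
      using holomorphic_derivI[OF f S in_S] .
    have "((\<lambda>t. f (z0 * exp (\<i> * t))) has_field_derivative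
        deriv f (z0 * exp (\<i> * t)) * (z0 * (exp (\<i> * t) * \<i>))) (at t)"
      by (rule DERIV_chain2[where f = f and g = "\<lambda>t. z0 * exp (\<i> * t)", OF df]) (auto intro!: derivative_eq_intros)
    also have "deriv f (z0 * exp (\<i> * t)) * (z0 * (exp (\<i> * t) * \<i>)) = \<i> * \<kappa> * f (z0 * exp (\<i> * t))"
      using ode[OF in_S] by (simp add: algebra_simps)
    finally have "(h has_field_derivative 0) (at t)"
      unfolding h_def by (auto intro!: derivative_eq_intros)
    then show "(h has_field_derivative 0) (at t within \<real>)"
      by (rule has_field_derivative_at_within)
  qed (rule convex_Reals)
  then have "h (of_real (2 * pi)) = h (of_real 0)"
    by (metis Reals_of_real)
  moreover have "exp (\<i> * of_real (2 * pi)) = 1"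
    by (metis exp_two_pi_i mult.commute of_real_mult of_real_numeral)
  ultimately have "exp (- (\<i> * \<kappa> * of_real (2 * pi))) = 1"
    using z0(2) by (simp add: h_def)
  then obtain n :: int where "Im \<kappa> = 0" "- (Re \<kappa> * (2 * pi)) = of_int (2 * n) * pi"
    by (auto simp: exp_eq_1)
  then have "pi * (Re \<kappa> + of_int n) = 0"
    by (simp add: algebra_simps)
  then have "\<kappa> = of_int (- n)"
    using \<open>Im \<kappa> = 0\<close> by (simp add: complex_eq_iff add_eq_0_iff2)
  then show ?thesis by (rule that)
qed

text \<open>By the identity theorem in the rotation parameter \<open>w\<close>, the relation
  \<open>f (w z) f z0 = f (w z0) f z\<close>, evident for powers of \<open>\<beta>\<close>, holds for all \<open>w\<close> near the
  unit circle; differentiate it at \<open>w = 1\<close>.\<close>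

lemma rotation_eigenfunction_euler:
  assumes \<beta>: "norm \<beta> = 1" "infinite (range (\<lambda>j::nat. \<beta> ^ j))"
    and f: "f holomorphic_on annulus R" and eig: "\<And>z. z \<in> annulus R \<Longrightarrow> f (\<beta> * z) = \<nu> * f z"
    and z: "z \<in> annulus R" and z0: "z0 \<in> annulus R"
  shows "z * deriv f z * f z0 = z0 * deriv f z0 * f z"
proof -
  have iter: "f (\<beta> ^ j * x) = \<nu> ^ j * f x" if "x \<in> annulus R" for j x
  proof (induction j)
    case (Suc j)
    have "\<beta> ^ j * x \<in> annulus R"
      using that \<beta> rotation_in_annulus_iff[of "\<beta> ^ j"] by (simp add: norm_power)
    then show ?case using eig Suc by (simp add: mult.assoc)
  qed simp
  define F where "F = (\<lambda>w. f (w * z) * f z0 - f (w * z0) * f z)"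
  have pos: "0 < norm z" "0 < norm z0"
    using z z0 zero_notin_annulus by auto
  \<comment> \<open>Exactly the \<open>w\<close> that keep both \<open>w * z\<close> and
    \<open>w * z0\<close> in the annulus. This set is again an annulus, written with
    \<open>w - 0\<close> to match \<open>connected_annulus\<close>.\<close>
  define D where "D = {w::complex. max (1 / R / norm z) (1 / R / norm z0) < norm (w - 0) \<and>
      norm (w - 0) < min (R / norm z) (R / norm z0)}"
  have D_iff: "w \<in> D \<longleftrightarrow> w * z \<in> annulus R \<and> w * z0 \<in> annulus R" for w
    using pos by (auto simp: D_def annulus_def norm_mult pos_divide_less_eq pos_less_divide_eq
        simp del: divide_divide_eq_left)
  have "open D"
    unfolding D_def by (intro open_Collect_conj open_Collect_less continuous_intros)
  have "connected D"
    unfolding D_def by (rule connected_annulus) simp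
  have D_sphere: "sphere 0 1 \<subseteq> D"
    using z z0 rotation_in_annulus_iff by (auto simp: D_iff)
  have fz: "(\<lambda>w. f (w * x)) holomorphic_on D" if "x = z \<or> x = z0" for x
    using that D_iff
    by (intro holomorphic_on_compose_gen[unfolded o_def, OF _ f, of "\<lambda>w. w * x"])
      (auto intro!: holomorphic_intros)
  have F: "F holomorphic_on D"
    unfolding F_def by (intro holomorphic_intros fz) auto
  have sub: "range (\<lambda>j. \<beta> ^ j) \<subseteq> sphere 0 1"
    using \<beta>(1) by (auto simp: norm_power)
  \<comment> \<open>Infinitely many powers of \<beta> on the compact circle accumulate there, giving
    the limit point for the identity theorem.\<close>
  obtain \<xi> where \<xi>: "\<xi> \<in> sphere 0 1" "\<xi> islimpt range (\<lambda>j. \<beta> ^ j)"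
    using Heine_Borel_imp_Bolzano_Weierstrass[OF compact_sphere \<beta>(2) sub] by blast
  have "F w = 0" if "w \<in> D" for w
  proof (rule analytic_continuation[OF F \<open>open D\<close> \<open>connected D\<close> _ _ \<xi>(2) _ that])
    show "range (\<lambda>j. \<beta> ^ j) \<subseteq> D" "\<xi> \<in> D" using sub \<xi>(1) D_sphere by auto
    show "F w = 0" if "w \<in> range (\<lambda>j. \<beta> ^ j)" for w
      using that iter z z0 by (auto simp: F_def)
  qed
  then have F0: "0 = F w" if "w \<in> D" for w using that by simp
  have "1 \<in> D" using D_sphere by auto
  have "(F has_field_derivative 0) (at 1)"
    by (rule has_field_derivative_transform_within_open[OF DERIV_const \<open>open D\<close> \<open>1 \<in> D\<close> F0])
  moreover have "(F has_field_derivative (deriv f z * z * f z0 - deriv f z0 * z0 * f z)) (at 1)"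
  proof -
    have "((\<lambda>w. f (w * x)) has_field_derivative deriv f x * x) (at 1)" if "x \<in> annulus R" for x
    proof (rule DERIV_chain2[of f])
      show "(f has_field_derivative deriv f x) (at (1 * x))"
        using holomorphic_derivI[OF f open_annulus that] by simp
    qed (auto intro!: derivative_eq_intros)
    from this[OF z] this[OF z0] show ?thesis
      unfolding F_def by (intro DERIV_diff DERIV_cmult_right)
  qed
  ultimately have "deriv f z * z * f z0 - deriv f z0 * z0 * f z = 0"
    by (rule DERIV_unique[symmetric])
  then show ?thesis by (simp add: mult.commute)
qed

text \<open>The factor \<open>z powi (- k)\<close> is an integrating factor: its product with
  \<open>f\<close> has derivative zero on a connected open set.\<close>

lemma euler_equation_solution:
  assumes f: "f holomorphic_on annulus R"
    and ode: "\<And>z. z \<in> annulus R \<Longrightarrow> z * deriv f z = of_int k * f z"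
  obtains C where "\<And>z. z \<in> annulus R \<Longrightarrow> f z = C * z powi k"
proof -
  have "(\<lambda>z. f z * z powi (- k)) constant_on annulus R"
  proof (rule has_field_derivative_0_imp_constant_on[OF _ _ open_annulus])
    show "connected (annulus R)"
      using connected_annulus(1)[of "1 / R" "0::complex" R] by (simp add: annulus_def)
    fix z assume z: "z \<in> annulus R"
    then have nz: "z \<noteq> 0" using zero_notin_annulus by blast
    have "((\<lambda>z. z powi (- k)) has_field_derivative of_int (- k) * z powi (- k - 1)) (at z)"
      using nz by (auto intro!: derivative_eq_intros)
    from DERIV_mult[OF holomorphic_derivI[OF f open_annulus z] this]
    have "((\<lambda>z. f z * z powi (- k)) has_field_derivative
        (deriv f z * z powi (- k) + of_int (- k) * z powi (- k - 1) * f z)) (at z)" .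
    also have "z powi (- k) = z * z powi (- k - 1)"
      using nz power_int_add_1'[of z "- k - 1"] by simp
    also have "deriv f z * (z * z powi (- k - 1)) + of_int (- k) * z powi (- k - 1) * f z =
        (z * deriv f z - of_int k * f z) * z powi (- k - 1)"
      by (simp add: algebra_simps)
    finally show "((\<lambda>z. f z * z powi (- k)) has_field_derivative 0) (at z)"
      by (simp add: ode[OF z])
  qed
  then obtain C where C: "\<forall>z\<in>annulus R. f z * z powi (- k) = C"
    by (auto simp: constant_on_def)
  show ?thesis
  proof (rule that)
    fix z assume z: "z \<in> annulus R"
    then have "z \<noteq> 0" using zero_notin_annulus by blast
    then show "f z = C * z powi k"
      using C z by (auto simp: power_int_minus field_simps)
  qed
qed

lemma rotation_eigenfunction_is_monomial:
  assumes \<beta>: "norm \<beta> = 1" "infinite (range (\<lambda>j::nat. \<beta> ^ j))" and \<alpha>: "\<alpha> \<noteq> 0"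
    and f: "f \<in> Ker (annulus R) (shift_op (rot_op \<alpha> \<beta>) \<mu>)" "f \<noteq> 0"
  obtains k C where "C \<noteq> 0" "f = fscale C (annulus_monomial R k)"
proof -
  have hol: "f holomorphic_on annulus R" and out: "\<And>z. z \<notin> annulus R \<Longrightarrow> f z = 0"
    and eig: "\<And>z. \<alpha> * f (\<beta> * z) = \<mu> * f z"
    using f(1) by (auto simp: in_Ker_shift_rot_op_iff Hol_def)
  have eig': "f (\<beta> * z) = \<mu> / \<alpha> * f z" for z
    using eig[of z] \<alpha> by (simp add: field_simps)
  obtain z0 where z0: "f z0 \<noteq> 0" using f(2) by (auto simp: fun_eq_iff)
  then have z0A: "z0 \<in> annulus R" using out by blast
  \<comment> \<open>The quotient \<open>z * deriv f z / f z\<close> at a point where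
    \<open>f\<close> does not vanish; the relation between \<open>z\<close> and \<open>z0\<close>
    makes it serve at every point.\<close>
  define \<kappa> where "\<kappa> = z0 * deriv f z0 / f z0"
  have euler: "z * deriv f z = \<kappa> * f z" if "z \<in> annulus R" for z
    using rotation_eigenfunction_euler[OF \<beta> hol eig' that z0A] z0
    by (simp add: \<kappa>_def field_simps)
  have "sphere 0 (norm z0) \<subseteq> annulus R"
    using z0A by (auto simp: annulus_def)
  then obtain k where "\<kappa> = of_int k"
    using logarithmic_derivative_integral[OF open_annulus hol euler _ z0] by blast
  with euler have "\<And>z. z \<in> annulus R \<Longrightarrow> z * deriv f z = of_int k * f z" by simp
  then obtain C where C: "\<And>z. z \<in> annulus R \<Longrightarrow> f z = C * z powi k"
    using euler_equation_solution[OF hol] by metis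
  show ?thesis
  proof (rule that)
    show "C \<noteq> 0" using C[OF z0A] z0 by auto
    show "f = fscale C (annulus_monomial R k)"
      using C out by (auto simp: fscale_def annulus_monomial_def fun_eq_iff)
  qed
qed

lemma monomial_eigenvalue:
  assumes "1 < R" "C \<noteq> 0" "norm \<beta> = 1"
    and "fscale C (annulus_monomial R k) \<in> Ker (annulus R) (shift_op (rot_op \<alpha> \<beta>) \<mu>)"
  shows "\<mu> = \<alpha> * \<beta> powi k"
proof -
  \<comment> \<open>At the point \<open>1\<close> every power equals 1, so the eigenvalue can be
    read off.\<close>
  have "\<alpha> * (C * annulus_monomial R k (\<beta> * 1)) = \<mu> * (C * annulus_monomial R k 1)"
    using assms(4) unfolding in_Ker_shift_rot_op_iff fscale_def by blast
  then show ?thesis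
    using assms one_in_annulus[of R] rotation_in_annulus_iff[of \<beta> 1 R]
    by (simp add: annulus_monomial_def)
qed

subsection \<open>The spectrum\<close>

text \<open>Here \<open>m\<close> is the order of \<beta>. Passing from \<open>n\<close> to
  \<open>m\<close> matters: if \<open>m < n\<close>, the equation \<open>z ^ n = 1\<close> has roots
  that are not powers of \<beta>.\<close>

lemma roots_of_unity_eq_powers:
  fixes \<beta> :: complex
  assumes "n \<ge> 1" "\<beta> ^ n = 1"
  obtains m where "1 \<le> m" "m \<le> n" "\<beta> ^ m = 1" "{z. z ^ m = 1} = (\<lambda>k. \<beta> ^ k) ` {..<m}"
proof -
  define m where "m = (LEAST m. 1 \<le> m \<and> \<beta> ^ m = 1)"
  have m: "1 \<le> m" "\<beta> ^ m = 1"
    unfolding m_def by (rule LeastI2[of _ n]; use assms in simp)+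
  have least: "m \<le> j" if "1 \<le> j" "\<beta> ^ j = 1" for j
    unfolding m_def by (rule Least_le) (use that in simp)
  have "\<beta> \<noteq> 0" using m by (auto simp: power_0_left)
  have ne: "\<beta> ^ i \<noteq> \<beta> ^ j" if "i < j" "j < m" for i j
  proof
    assume "\<beta> ^ i = \<beta> ^ j"
    then have "\<beta> ^ (j - i) = 1"
      using that \<open>\<beta> \<noteq> 0\<close> by (simp add: power_diff)
    then have "m \<le> j - i" using that by (intro least) simp_all
    then show False using that by linarith
  qed
  have inj: "inj_on (\<lambda>k. \<beta> ^ k) {..<m}"
  proof (rule linorder_inj_onI)
    fix i j assume "i < j" "j \<in> {..<m}"
    then show "\<beta> ^ i \<noteq> \<beta> ^ j" using ne by simp
  qed auto
  have "(\<lambda>k. \<beta> ^ k) ` {..<m} = {z. z ^ m = 1}"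
  \<comment> \<open>The \<open>m\<close> powers are distinct and are all roots, and there are
    exactly \<open>m\<close> roots.\<close>
  proof (rule card_subset_eq)
    show "finite {z::complex. z ^ m = 1}"
      using m(1) by (intro finite_roots_unity) simp
    have "(\<beta> ^ k) ^ m = (\<beta> ^ m) ^ k" for k by (simp add: mult.commute flip: power_mult)
    then show "(\<lambda>k. \<beta> ^ k) ` {..<m} \<subseteq> {z. z ^ m = 1}" using m(2) by auto
    show "card ((\<lambda>k. \<beta> ^ k) ` {..<m}) = card {z::complex. z ^ m = 1}"
      using m(1) by (simp add: card_image[OF inj] card_roots_unity_eq)
  qed
  with m least[OF assms] that show ?thesis by simp
qed

text \<open>With \<open>m\<close> the order of \<beta>, a spectral value satisfies
  \<open>\<mu> ^ m = \<alpha> ^ m\<close>, so \<open>\<mu> / \<alpha>\<close> is an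
  \<open>m\<close>-th root of unity and hence a power of \<beta>. Conversely, monomials realise each
  listed value.\<close>

lemma spectrum_rot_op_root_of_unity:
  assumes R: "1 < R" and \<alpha>: "norm \<alpha> = 1" and \<beta>: "norm \<beta> = 1" and n: "n \<ge> 1" "\<beta> ^ n = 1"
  shows "spectrum (annulus R) (rot_op \<alpha> \<beta>) \<subseteq> {\<alpha> * \<beta> ^ k | k. k \<le> n - 1}"
    and "{\<alpha> * \<beta> ^ k | k::nat. k \<le> n - 1} \<subseteq> point_spectrum (annulus R) (rot_op \<alpha> \<beta>)"
proof
  have \<alpha>0: "\<alpha> \<noteq> 0" using \<alpha> by auto
  obtain m where m: "1 \<le> m" "m \<le> n" "\<beta> ^ m = 1" "{z. z ^ m = 1} = (\<lambda>k. \<beta> ^ k) ` {..<m}"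
    using roots_of_unity_eq_powers[OF n] .
  fix \<mu> assume "\<mu> \<in> spectrum (annulus R) (rot_op \<alpha> \<beta>)"
  then have "\<mu> ^ m = \<alpha> ^ m"
    using invertible_shift_rot_op_root_of_unity[OF \<beta> m(3)] by (auto simp: spectrum_def)
  then have "(\<mu> / \<alpha>) ^ m = 1" using \<alpha>0 by (simp add: power_divide)
  then obtain k where "k < m" "\<mu> / \<alpha> = \<beta> ^ k" using m(4) by blast
  then have "\<mu> = \<alpha> * \<beta> ^ k" "k \<le> n - 1" using \<alpha>0 m(2) by (auto simp: field_simps)
  then show "\<mu> \<in> {\<alpha> * \<beta> ^ k | k. k \<le> n - 1}" by blast
next
  show "{\<alpha> * \<beta> ^ k | k::nat. k \<le> n - 1} \<subseteq> point_spectrum (annulus R) (rot_op \<alpha> \<beta>)"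
    using monomial_eigenvalue_in_point_spectrum[OF R \<beta>, of \<alpha> "int _"] by auto
qed

text \<open>Exponents congruent to \<open>k\<close> modulo \<open>n\<close> all yield the same
  eigenvalue, so one kernel contains infinitely many monomials.\<close>

lemma infinite_dim_Ker_root_of_unity:
  assumes R: "1 < R" and \<beta>: "norm \<beta> = 1" and n: "n \<ge> 1" "\<beta> ^ n = 1"
  shows "infinite_dim (Ker (annulus R) (shift_op (rot_op \<alpha> \<beta>) (\<alpha> * \<beta> ^ k)))"
proof (rule infinite_dim_if_monomials[OF R])
  have "inj (\<lambda>j. k + j * n)" using n(1) by (auto simp: inj_def)
  then show "infinite (range (\<lambda>j. k + j * n))" by (rule range_inj_infinite)
  fix i assume "i \<in> range (\<lambda>j. k + j * n)"
  then obtain j where "i = k + j * n" by blast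
  then have "\<beta> ^ i = \<beta> ^ k * (\<beta> ^ n) ^ j"
    by (simp add: power_add mult.commute flip: power_mult)
  then show "annulus_monomial R (int i) \<in> Ker (annulus R) (shift_op (rot_op \<alpha> \<beta>) (\<alpha> * \<beta> ^ k))"
    using annulus_monomial_eigenfunction[OF \<beta>, of R "int i" \<alpha>] n(2) by simp
qed

lemma spectrum_rot_op_subset_circle:
  assumes "norm \<alpha> = 1" "norm \<beta> = 1"
  shows "spectrum (annulus R) (rot_op \<alpha> \<beta>) \<subseteq> sphere 0 1"
proof
  fix \<mu> assume "\<mu> \<in> spectrum (annulus R) (rot_op \<alpha> \<beta>)"
  then have "\<not> 1 < norm \<mu>" "\<not> norm \<mu> < 1"
    using invertible_shift_rot_op_large[OF assms] invertible_shift_rot_op_small[OF assms]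
    by (auto simp: spectrum_def)
  then show "\<mu> \<in> sphere 0 1" by simp
qed

lemma point_spectrum_rot_op_infinite_order:
  assumes R: "1 < R" and \<alpha>: "\<alpha> \<noteq> 0" and \<beta>: "norm \<beta> = 1" "infinite (range (\<lambda>j::nat. \<beta> ^ j))"
  shows "point_spectrum (annulus R) (rot_op \<alpha> \<beta>) = {\<alpha> * \<beta> powi k | k::int. True}"
proof
  show "point_spectrum (annulus R) (rot_op \<alpha> \<beta>) \<subseteq> {\<alpha> * \<beta> powi k | k::int. True}"
  proof
    fix \<mu> assume "\<mu> \<in> point_spectrum (annulus R) (rot_op \<alpha> \<beta>)"
    then obtain f where f: "f \<in> Ker (annulus R) (shift_op (rot_op \<alpha> \<beta>) \<mu>)" "f \<noteq> 0"
      by (auto simp: in_point_spectrum_rot_op_iff)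
    obtain k C where "C \<noteq> 0" "f = fscale C (annulus_monomial R k)"
      by (rule rotation_eigenfunction_is_monomial[OF \<beta> \<alpha> f])
    then have "\<mu> = \<alpha> * \<beta> powi k"
      using monomial_eigenvalue[OF R _ \<beta>(1)] f(1) by blast
    then show "\<mu> \<in> {\<alpha> * \<beta> powi k | k::int. True}" by blast
  qed
  show "{\<alpha> * \<beta> powi k | k::int. True} \<subseteq> point_spectrum (annulus R) (rot_op \<alpha> \<beta>)"
    using monomial_eigenvalue_in_point_spectrum[OF R \<beta>(1)] by blast
qed

text \<open>Distinct monomials have distinct eigenvalues when the powers of \<beta> are distinct, so
  the kernel is the line spanned by one monomial.\<close>

lemma dim_Ker_infinite_order:
  assumes R: "1 < R" and \<alpha>: "\<alpha> \<noteq> 0" and \<beta>: "norm \<beta> = 1" "inj (\<lambda>k::int. \<beta> powi k)"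
    "infinite (range (\<lambda>j::nat. \<beta> ^ j))"
  shows "cfun.dim (Ker (annulus R) (shift_op (rot_op \<alpha> \<beta>) (\<alpha> * \<beta> powi k))) = 1"
proof -
  let ?K = "Ker (annulus R) (shift_op (rot_op \<alpha> \<beta>) (\<alpha> * \<beta> powi k))"
  let ?e = "annulus_monomial R k"
  have "f \<in> range (\<lambda>c. fscale c ?e)" if f: "f \<in> ?K" for f
  proof (cases "f = 0")
    case True
    then have "f = fscale 0 ?e" by (simp add: fscale_def fun_eq_iff)
    then show ?thesis by blast
  next
    case False
    obtain j C where C: "C \<noteq> 0" "f = fscale C (annulus_monomial R j)"
      by (rule rotation_eigenfunction_is_monomial[OF \<beta>(1,3) \<alpha> f False])
    then have "\<alpha> * \<beta> powi k = \<alpha> * \<beta> powi j"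
      using monomial_eigenvalue[OF R _ \<beta>(1)] f by blast
    then have "k = j" using \<alpha> \<beta>(2) by (simp add: inj_eq)
    then show ?thesis using C by blast
  qed
  moreover have "fscale c ?e \<in> ?K" for c
    using annulus_monomial_eigenfunction[OF \<beta>(1), of R k \<alpha>] Hol_scale
    by (auto simp: in_Ker_shift_rot_op_iff fscale_def)
  ultimately have "?K = cfun.span {?e}"
    by (auto simp: cfun.span_singleton)
  moreover have "cfun.independent {?e}"
    using annulus_monomial_neq_0[OF R] by simp
  ultimately show ?thesis
    using cfun.dim_span_eq_card_independent[of "{?e}"] by simp
qed

lemma inj_powi_if_infinite_order:
  fixes \<beta> :: complex
  assumes "\<beta> \<noteq> 0" "\<And>n::int. n \<noteq> 0 \<Longrightarrow> \<beta> powi n \<noteq> 1"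
  shows "inj (\<lambda>k::int. \<beta> powi k)"
proof (rule injI)
  fix i j :: int assume "\<beta> powi i = \<beta> powi j"
  then have "\<beta> powi (i - j) = 1" using assms(1) by (simp add: power_int_diff)
  then show "i = j" using assms(2)[of "i - j"] by fastforce
qed

theorem theorem6p2:
  fixes R :: real and \<alpha> \<beta> :: complex
  assumes "R > 1" and "\<alpha> \<in> sphere 0 1" and "\<beta> \<in> sphere 0 1"
  shows
    "(\<forall>n::nat. n \<ge> 1 \<longrightarrow> \<beta> ^ n = 1 \<longrightarrow>
        point_spectrum (annulus R) (rot_op \<alpha> \<beta>) = spectrum (annulus R) (rot_op \<alpha> \<beta>) \<and>
        spectrum (annulus R) (rot_op \<alpha> \<beta>) = {\<alpha> * \<beta> ^ k | k::nat. 0 \<le> k \<and> k \<le> n - 1} \<and>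
        (\<forall>\<mu> \<in> point_spectrum (annulus R) (rot_op \<alpha> \<beta>).
           infinite_dim (Ker (annulus R) (shift_op (rot_op \<alpha> \<beta>) \<mu>)))) \<and>
     ((\<forall>n::int. n \<noteq> 0 \<longrightarrow> \<beta> powi n \<noteq> 1) \<longrightarrow>
        point_spectrum (annulus R) (rot_op \<alpha> \<beta>) = {\<alpha> * \<beta> powi k | k::int. True} \<and>
        {\<alpha> * \<beta> powi k | k::int. True} \<subseteq> spectrum (annulus R) (rot_op \<alpha> \<beta>) \<and>
        spectrum (annulus R) (rot_op \<alpha> \<beta>) \<subseteq> sphere 0 1 \<and>
        (\<forall>\<mu> \<in> point_spectrum (annulus R) (rot_op \<alpha> \<beta>).
           cfun.dim (Ker (annulus R) (shift_op (rot_op \<alpha> \<beta>) \<mu>)) = 1))"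
proof (intro conjI allI impI)
  have R: "1 < R" and \<alpha>: "norm \<alpha> = 1" "\<alpha> \<noteq> 0" and \<beta>: "norm \<beta> = 1" "\<beta> \<noteq> 0"
    using assms by auto
  {
    fix n :: nat assume n: "n \<ge> 1" "\<beta> ^ n = 1"
    \<comment> \<open>The inclusions form a cycle: listed values, point spectrum, spectrum, listed
      values. Hence all three sets agree.\<close>
    note spec = spectrum_rot_op_root_of_unity[OF R \<alpha>(1) \<beta>(1) n]
      point_spectrum_subset_spectrum[of "annulus R" "rot_op \<alpha> \<beta>"]
    show "point_spectrum (annulus R) (rot_op \<alpha> \<beta>) = spectrum (annulus R) (rot_op \<alpha> \<beta>)"
      and eq: "spectrum (annulus R) (rot_op \<alpha> \<beta>) = {\<alpha> * \<beta> ^ k | k::nat. 0 \<le> k \<and> k \<le> n - 1}"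
      using spec by auto
    show "\<forall>\<mu> \<in> point_spectrum (annulus R) (rot_op \<alpha> \<beta>).
        infinite_dim (Ker (annulus R) (shift_op (rot_op \<alpha> \<beta>) \<mu>))"
      using spec infinite_dim_Ker_root_of_unity[OF R \<beta>(1) n, of \<alpha>] by blast
  }
  assume "\<forall>n::int. n \<noteq> 0 \<longrightarrow> \<beta> powi n \<noteq> 1"
  then have inj: "inj (\<lambda>k::int. \<beta> powi k)"
    using inj_powi_if_infinite_order[OF \<beta>(2)] by blast
  \<comment> \<open>Natural powers are distinct as well, which supplies the infinite set for the
    accumulation argument.\<close>
  have "inj (\<lambda>j::nat. \<beta> ^ j)"
    using inj_compose[OF inj, of int] by (simp add: o_def inj_def)
  then have inf: "infinite (range (\<lambda>j::nat. \<beta> ^ j))" by (rule range_inj_infinite)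
  show ps: "point_spectrum (annulus R) (rot_op \<alpha> \<beta>) = {\<alpha> * \<beta> powi k | k::int. True}"
    by (rule point_spectrum_rot_op_infinite_order[OF R \<alpha>(2) \<beta>(1) inf])
  show "{\<alpha> * \<beta> powi k | k::int. True} \<subseteq> spectrum (annulus R) (rot_op \<alpha> \<beta>)"
    unfolding ps[symmetric] by (rule point_spectrum_subset_spectrum)
  show "spectrum (annulus R) (rot_op \<alpha> \<beta>) \<subseteq> sphere 0 1"
    by (rule spectrum_rot_op_subset_circle[OF \<alpha>(1) \<beta>(1)])
  show "\<forall>\<mu> \<in> point_spectrum (annulus R) (rot_op \<alpha> \<beta>).
      cfun.dim (Ker (annulus R) (shift_op (rot_op \<alpha> \<beta>) \<mu>)) = 1"
    unfolding ps using dim_Ker_infinite_order[OF R \<alpha>(2) \<beta>(1) inj inf] by blast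
qed

end
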